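(* Let $X,Y$ be real Banach spaces, $A:X\to Y$ bounded linear, $y^\dagger\in Y$, $p>1$, and $\Omega:X\to(-\infty,+\infty]$ satisfying the standing assumptions (i)–(iii) of the context, and let $x^\dagger$ be an $\Omega$-minimizing solution of $A\,x=y^\dagger$. Define $$D(r):=\sup_{x\in X}\bigl(\Omega(x^\dagger)-\Omega(x)-r\,\|A\,x-A\,x^\dagger\|\bigr)\quad(r\ge 0),\qquad \Phi(r):=\frac{D(r)}{r}\quad(r>0).$$ Assume $D(r)>0$ for all $r\ge 0$. Let $c_1,c_2>0$ be constants and let $\alpha:(0,\infty)\to(0,\infty)$, $\delta\mapsto\alpha(\delta)$, be an a priori parameter choice with $$c_1\,\frac{\delta^p}{D(\Phi^{-1}(\delta))}\le\alpha(\delta)\le c_2\,\frac{\delta^p}{D(\Phi^{-1}(\delta))}\qquad\text{for all }\delta>0.$$ Then there is a constant $c>0$ such that for all $\delta>0$, all $y^\delta\in Y$ with $\|y^\delta-y^\dagger\|\le\delta$, all minimizers $x_\alpha^\delta$ of the Tikhonov functional $T_\alpha^\delta$ with $\alpha=\alpha(\delta)$, and all associated subgradients $\xi_\alpha^\delta=A^\ast\eta_\alpha^\delta$ as described in the context, $$D\bigl(c\,\Phi^{-1}(\delta)\bigr)\le B^\Omega_{\xi_\alpha^\delta}(x^\dagger,x_\alpha^\delta).$$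
   Context: Setting: $X,Y$ are real Banach spaces, $A:X\to Y$ is a bounded linear operator with adjoint $A^\ast:Y^\ast\to X^\ast$, $y^\dagger\in Y$, $p>1$, $\Omega:X\to(-\infty,+\infty]$. Standing assumptions: (i) the equation $A\,x=y^\dagger$ has a solution $x$ with $\Omega(x)<\infty$; (ii) $\Omega$ is proper and convex; (iii) for every $c\in\mathbb{R}$ the sublevel set $\{x\in X:\Omega(x)\le c\}$ is weakly sequentially closed and each sequence in it has a weakly convergent subsequence. An $\Omega$-minimizing solution $x^\dagger$ is a solution of $A\,x=y^\dagger$ minimizing $\Omega$ among all solutions of this equation (so $\Omega(x^\dagger)<\infty$). For noise level $\delta$, data $y^\delta\in Y$ with $\|y^\delta-y^\dagger\|\le\delta$, and $\alpha>0$, the Tikhonov functional is $T_\alpha^\delta(x):=\frac1p\|A\,x-y^\delta\|^p+\alpha\,\Omega(x)$, $x\in X$; $x_\alpha^\delta$ denotes a minimizer of it over $X$. For such a minimizer there exists $\eta_\alpha^\delta\in Y^\ast$ with $$\eta_\alpha^\delta\in-\frac1\alpha\,\partial\Bigl(\frac1p\|\cdot\|^p\Bigr)(A\,x_\alpha^\delta-y^\delta)\quad\text{and}\quad A^\ast\eta_\alpha^\delta\in\partial\Omega(x_\alpha^\delta);$$ $\eta_\alpha^\delta$ denotes any such element and $\xi_\alpha^\delta:=A^\ast\eta_\alpha^\delta$. Here $\partial$ denotes the convex subdifferential, and $\partial(\frac1p\|\cdot\|^p)(y)=\{\eta\in Y^\ast:\langle\eta,y\rangle=\|\eta\|\,\|y\|,\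 \|\eta\|=\|y\|^{p-1}\}$ for $y\in Y$. Bregman distance: for $\bar x\in X$ and $\bar\xi\in\partial\Omega(\bar x)$, $B^\Omega_{\bar\xi}(x,\bar x):=\Omega(x)-\Omega(\bar x)-\langle\bar\xi,x-\bar x\rangle$ for $x\in X$. The function $D$ takes finite values in $[0,\infty)$, and if $D(r)>0$ for all $r\ge0$, then $\Phi:(0,\infty)\to(0,\infty)$ is a bijection, with inverse $\Phi^{-1}:(0,\infty)\to(0,\infty)$. *)

theory Defs
  imports "HOL-Analysis.Analysis"
begin

text \<open>
  The topological dual of a real Banach space \<open>'a\<close> is the type \<open>'a \<Rightarrow>\<^sub>L real\<close> of bounded linear
  functionals with the operator norm. Functions into the half-open extended line are modelled as
  \<^typ>\<open>ereal\<close>-valued functions that never attain \<open>-\<infinity>\<close>; that condition is part of properness.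
\<close>

definition banach_adjoint ::
    "('a::real_normed_vector \<Rightarrow>\<^sub>L 'b::real_normed_vector) \<Rightarrow> ('b \<Rightarrow>\<^sub>L real) \<Rightarrow> ('a \<Rightarrow>\<^sub>L real)" where
  "banach_adjoint A \<eta> = \<eta> o\<^sub>L A"

definition weakly_converges :: "(nat \<Rightarrow> 'a::real_normed_vector) \<Rightarrow> 'a \<Rightarrow> bool" where
  "weakly_converges u x \<longleftrightarrow>
    (\<forall>f :: 'a \<Rightarrow>\<^sub>L real. (\<lambda>n. blinfun_apply f (u n)) \<longlonglongrightarrow> blinfun_apply f x)"

definition weakly_seq_closed :: "'a::real_normed_vector set \<Rightarrow> bool" where
  "weakly_seq_closed S \<longleftrightarrow>
    (\<forall>u x. (\<forall>n. u n \<in> S) \<longrightarrow> weakly_converges u x \<longrightarrow> x \<in> S)"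

definition has_weakly_convergent_subseqs :: "'a::real_normed_vector set \<Rightarrow> bool" where
  "has_weakly_convergent_subseqs S \<longleftrightarrow>
    (\<forall>u. (\<forall>n. u n \<in> S) \<longrightarrow>
      (\<exists>r x. strict_mono (r :: nat \<Rightarrow> nat) \<and> weakly_converges (u \<circ> r) x))"

definition proper_fun :: "('a \<Rightarrow> ereal) \<Rightarrow> bool" where
  "proper_fun F \<longleftrightarrow> (\<forall>x. F x \<noteq> -\<infinity>) \<and> (\<exists>x. F x < \<infinity>)"

text \<open>The library's \<^const>\<open>convex_on\<close> covers real-valued functions only.\<close>

definition convex_fun :: "('a::real_vector \<Rightarrow> ereal) \<Rightarrow> bool" where
  "convex_fun F \<longleftrightarrow>
    (\<forall>x y. \<forall>u\<ge>0. \<forall>v\<ge>0. u + v = 1 \<longrightarrow>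
      F (u *\<^sub>R x + v *\<^sub>R y) \<le> ereal u * F x + ereal v * F y)"

text \<open>As usual, the subdifferential is empty at points outside the effective domain.\<close>

definition subdifferential :: "('a::real_normed_vector \<Rightarrow> ereal) \<Rightarrow> 'a \<Rightarrow> ('a \<Rightarrow>\<^sub>L real) set" where
  "subdifferential F x =
    {\<xi>. \<bar>F x\<bar> \<noteq> \<infinity> \<and> (\<forall>z. F x + ereal (blinfun_apply \<xi> (z - x)) \<le> F z)}"

text \<open>Meaningful only for \<open>\<xi> \<in> subdifferential \<Omega> xb\<close>.\<close>

definition bregman_distance ::
    "('a::real_normed_vector \<Rightarrow> ereal) \<Rightarrow> ('a \<Rightarrow>\<^sub>L real) \<Rightarrow> 'a \<Rightarrow> 'a \<Rightarrow> ereal" where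
  "bregman_distance \<Omega> \<xi> x xb = \<Omega> x - \<Omega> xb - ereal (blinfun_apply \<xi> (x - xb))"

definition Omega_min_solution ::
    "('a::real_normed_vector \<Rightarrow>\<^sub>L 'b::real_normed_vector) \<Rightarrow> 'b \<Rightarrow> ('a \<Rightarrow> ereal) \<Rightarrow> 'a \<Rightarrow> bool" where
  "Omega_min_solution A y \<Omega> x \<longleftrightarrow> is_arg_min \<Omega> (\<lambda>z. blinfun_apply A z = y) x"

definition tikhonov ::
    "('a::real_normed_vector \<Rightarrow>\<^sub>L 'b::real_normed_vector) \<Rightarrow> real \<Rightarrow> ('a \<Rightarrow> ereal) \<Rightarrow> real \<Rightarrow> 'b \<Rightarrow> 'a \<Rightarrow> ereal"
  where
  "tikhonov A p \<Omega> \<alpha> yd x = ereal (1 / p * norm (blinfun_apply A x - yd) powr p) + ereal \<alpha> * \<Omega> x"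

definition tikhonov_minimizer ::
    "('a::real_normed_vector \<Rightarrow>\<^sub>L 'b::real_normed_vector) \<Rightarrow> real \<Rightarrow> ('a \<Rightarrow> ereal) \<Rightarrow> real \<Rightarrow> 'b \<Rightarrow> 'a \<Rightarrow> bool"
  where
  "tikhonov_minimizer A p \<Omega> \<alpha> yd x \<longleftrightarrow> is_arg_min (tikhonov A p \<Omega> \<alpha> yd) (\<lambda>_. True) x"

text \<open>The elements \<open>\<eta>\<close> of the dual of \<open>Y\<close> occurring in the optimality condition at \<open>x\<close>.\<close>

definition dual_optimal ::
    "('a::real_normed_vector \<Rightarrow>\<^sub>L 'b::real_normed_vector) \<Rightarrow> real \<Rightarrow> ('a \<Rightarrow> ereal) \<Rightarrow> real \<Rightarrow> 'b \<Rightarrow> 'a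
      \<Rightarrow> ('b \<Rightarrow>\<^sub>L real) set" where
  "dual_optimal A p \<Omega> \<alpha> yd x =
    {\<eta>. \<eta> \<in> (\<lambda>\<zeta>. - (1 / \<alpha>) *\<^sub>R \<zeta>) `
              subdifferential (\<lambda>y. ereal (1 / p * norm y powr p)) (blinfun_apply A x - yd)
        \<and> banach_adjoint A \<eta> \<in> subdifferential \<Omega> x}"

definition D_fun ::
    "('a::real_normed_vector \<Rightarrow>\<^sub>L 'b::real_normed_vector) \<Rightarrow> ('a \<Rightarrow> ereal) \<Rightarrow> 'a \<Rightarrow> real \<Rightarrow> ereal" where
  "D_fun A \<Omega> xdag r =
    (SUP x. \<Omega> xdag - \<Omega> x - ereal (r * norm (blinfun_apply A x - blinfun_apply A xdag)))"

text \<open>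
  Under the hypotheses of the theorem \<^const>\<open>D_fun\<close> has values in \<open>[0,\<infinity>)\<close> for \<open>r \<ge> 0\<close>, so the
  conversion to \<^typ>\<open>real\<close> below loses nothing, and \<open>Phi_fun\<close> is a bijection of \<open>(0,\<infinity>)\<close> once
  \<^const>\<open>D_fun\<close> is positive.
\<close>

definition Phi_fun ::
    "('a::real_normed_vector \<Rightarrow>\<^sub>L 'b::real_normed_vector) \<Rightarrow> ('a \<Rightarrow> ereal) \<Rightarrow> 'a \<Rightarrow> real \<Rightarrow> real" where
  "Phi_fun A \<Omega> xdag r = real_of_ereal (D_fun A \<Omega> xdag r) / r"

definition Phi_inv ::
    "('a::real_normed_vector \<Rightarrow>\<^sub>L 'b::real_normed_vector) \<Rightarrow> ('a \<Rightarrow> ereal) \<Rightarrow> 'a \<Rightarrow> real \<Rightarrow> real" where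
  "Phi_inv A \<Omega> xdag = the_inv_into {0<..} (Phi_fun A \<Omega> xdag)"

end

theory Submission
  imports Defs
begin

text \<open>
  Comparing with the subgradient inequality at \<open>x\<close> yields \<open>D(\<parallel>\<eta>\<parallel>) \<le> B\<close>, the Bregman distance in
  question, so as \<open>D\<close> is decreasing it is enough to show \<open>\<parallel>\<eta>\<parallel> \<le> c \<cdot> r\<close> for \<open>r = \<Phi>\<inverse>(\<delta>)\<close>. As
  \<open>D(r) = r \<delta>\<close>, the parameter choice reads \<open>c\<^sub>1 \<delta>\<^sup>p\<^sup>-\<^sup>1 \<le> \<alpha> r \<le> c\<^sub>2 \<delta>\<^sup>p\<^sup>-\<^sup>1\<close>. Minimality of \<open>x\<close> and
  \<open>\<Omega>(x\<^sup>\<dagger>) - \<Omega>(x) \<le> D(r) + r \<parallel>A x - y\<^sup>\<dagger>\<parallel>\<close> then bound the residual \<open>\<parallel>A x - y\<^sup>\<delta>\<parallel>\<close> by a multiple of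
  \<open>\<delta>\<close>, hence \<open>\<alpha> \<parallel>\<eta>\<parallel>\<close> by a multiple of \<open>\<delta>\<^sup>p\<^sup>-\<^sup>1\<close>. The supremum \<open>D\<close> is finite because \<open>\<Omega>\<close> is
  bounded below, and \<open>\<Phi>\<close> is bijective because \<open>D\<close> is convex, hence continuous.
\<close>

text \<open>Otherwise points with values at most \<open>- n\<close> have a weakly convergent
  subsequence, whose limit lies in every sublevel set and so would have the value
  \<open>-\<infinity>\<close>.\<close>

lemma bounded_below_of_weakly_compact_sublevels:
  fixes F :: "'a::real_normed_vector \<Rightarrow> ereal"
  assumes nm: "\<And>x. F x \<noteq> -\<infinity>"
    and closed: "\<And>c::real. weakly_seq_closed {x. F x \<le> ereal c}"
    and sub: "\<And>c::real. has_weakly_convergent_subseqs {x. F x \<le> ereal c}"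
  obtains m :: real where "\<And>x. ereal m \<le> F x"
proof -
  have "\<exists>m::real. \<forall>x. ereal m \<le> F x"
  proof (rule ccontr)
    assume "\<not> ?thesis"
    then have "\<forall>n::nat. \<exists>x. F x \<le> ereal (- real n)"
      by (meson linear)
    then obtain u where u: "\<And>n::nat. F (u n) \<le> ereal (- real n)"
      by metis
    have "F (u n) \<le> ereal 0" for n
      by (rule order_trans[OF u]) simp
    then obtain r x where r: "strict_mono (r :: nat \<Rightarrow> nat)" and x: "weakly_converges (u \<circ> r) x"
      using sub[of 0] unfolding has_weakly_convergent_subseqs_def by blast
    have le: "F x \<le> ereal (- real k)" for k :: nat
    proof -
      \<comment> \<open>Since \<open>k \<le> r (n + k)\<close>, dropping the first \<open>k\<close>
        terms leaves a sequence inside the sublevel set of level \<open>- k\<close>.\<close>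
      have "F ((u \<circ> r) (n + k)) \<le> ereal (- real k)" for n
      proof -
        have "k \<le> r (n + k)"
          using seq_suble[OF r, of "n + k"] by linarith
        then have "ereal (- real (r (n + k))) \<le> ereal (- real k)"
          by simp
        with u[of "r (n + k)"] show ?thesis
          by (simp add: order_trans)
      qed
      moreover have "weakly_converges (\<lambda>n. (u \<circ> r) (n + k)) x"
        using x LIMSEQ_ignore_initial_segment unfolding weakly_converges_def by blast
      ultimately show ?thesis
        using closed[of "- real k"] unfolding weakly_seq_closed_def mem_Collect_eq by metis
    qed
    show False
    proof (cases "F x")
      case (real w)
      obtain k :: nat where "- w < real k"
        using reals_Archimedean2 by blast
      with le[of k] real show False by simp
    next
      case PInf
      with le[of 0] show False by simp
    next
      case MInf
      with nm show False by blast
    qed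
  qed
  with that show thesis by blast
qed

text \<open>Strict decrease of the quotient gives injectivity. Convexity on an open interval gives
  continuity, so the intermediate value theorem gives surjectivity.\<close>

lemma bij_betw_convex_antimono_divide:
  fixes f :: "real \<Rightarrow> real"
  assumes conv: "convex_on {0<..} f"
    and anti: "\<And>r s. 0 < r \<Longrightarrow> r \<le> s \<Longrightarrow> f s \<le> f r"
    and pos: "\<And>r. 0 < r \<Longrightarrow> 0 < f r"
  shows "bij_betw (\<lambda>r. f r / r) {0<..} {0<..}"
  unfolding bij_betw_def
proof
  have less: "f s / s < f r / r" if "0 < r" "r < s" for r s
  proof -
    have "f s / s \<le> f r / s"
      using anti[of r s] that by (intro divide_right_mono) auto
    also have "\<dots> < f r / r"
      using that pos[of r] by (intro divide_strict_left_mono) auto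
    finally show ?thesis .
  qed
  show "inj_on (\<lambda>r. f r / r) {0<..}"
  proof (rule inj_onI)
    fix r s :: real
    assume "r \<in> {0<..}" "s \<in> {0<..}" "f r / r = f s / s"
    then show "r = s"
      using less[of r s] less[of s r] by (cases r s rule: linorder_cases) auto
  qed
  show "(\<lambda>r. f r / r) ` {0<..} = {0<..}"
  proof (intro equalityI subsetI)
    fix y assume "y \<in> (\<lambda>r. f r / r) ` {0<..}"
    then show "y \<in> {0<..}" using pos by auto
  next
    fix y :: real assume "y \<in> {0<..}"
    then have y: "0 < y" by simp
    \<comment> \<open>The comparison function \<open>f 1 / r\<close> takes the value
      \<open>y\<close> at \<open>f 1 / y\<close>. Cutting off at 1 puts \<open>a\<close> and
      \<open>b\<close> on the sides of 1 where monotonicity gives \<open>f a \<ge> f 1\<close> and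
      \<open>f b \<le> f 1\<close>.\<close>
    define a where "a = min 1 (f 1 / y)"
    define b where "b = max 1 (f 1 / y)"
    have a: "0 < a" "a \<le> 1" "a * y \<le> f 1"
      using y pos[of 1] by (auto simp: a_def min_def field_simps)
    have b: "1 \<le> b" "f 1 \<le> b * y"
      using y by (auto simp: b_def max_def field_simps)
    have "continuous_on {0<..} f"
      by (rule convex_on_continuous[OF _ conv]) simp
    then have "continuous_on {a..b} f"
      by (rule continuous_on_subset) (use a in auto)
    then have cont: "continuous_on {a..b} (\<lambda>r. f r / r)"
      by (intro continuous_intros) (use a in auto)
    have "f b / b \<le> y"
      using anti[of 1 b] b by (simp add: field_simps)
    moreover have "y \<le> f a / a"
      using anti[of a 1] a by (simp add: field_simps)
    ultimately obtain x where "a \<le> x" "x \<le> b" "f x / x = y"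
      using IVT2'[of "\<lambda>r. f r / r" b y a] a b cont by force
    with a show "y \<in> (\<lambda>r. f r / r) ` {0<..}"
      by (auto intro!: image_eqI[of _ _ x])
  qed
qed

section \<open>Monotonicity, finiteness and convexity of \<open>D_fun\<close>\<close>

lemma D_fun_antimono:
  assumes "r \<le> s"
  shows "D_fun A \<Omega> xdag s \<le> D_fun A \<Omega> xdag r"
  unfolding D_fun_def
  using assms by (intro SUP_mono') (auto intro!: ereal_minus_mono mult_right_mono)

lemma D_fun_finite:
  assumes m: "\<And>x. ereal m \<le> \<Omega> x" and fin: "\<Omega> xdag = ereal w" and "0 \<le> r"
  shows "\<bar>D_fun A \<Omega> xdag r\<bar> \<noteq> \<infinity>"
proof -
  have "D_fun A \<Omega> xdag r \<le> ereal (w - m)"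
    unfolding D_fun_def
  proof (rule SUP_least)
    fix x
    show "\<Omega> xdag - \<Omega> x - ereal (r * norm (blinfun_apply A x - blinfun_apply A xdag)) \<le> ereal (w - m)"
      using m[of x] fin \<open>0 \<le> r\<close>
      by (cases "\<Omega> x") (auto intro: add_mono order_trans simp: algebra_simps add_increasing)
  qed
  moreover have "0 \<le> D_fun A \<Omega> xdag r"
    unfolding D_fun_def by (rule SUP_upper2[of xdag]) (auto simp: fin)
  ultimately show ?thesis by auto
qed

text \<open>In \<open>r\<close>, \<open>D_fun\<close> is a supremum of affine functions, one for
  each \<open>x\<close> with finite \<open>\<Omega> x\<close>; every other \<open>x\<close>
  contributes \<open>-\<infinity>\<close>.\<close>

lemma convex_on_D_fun:
  assumes m: "\<And>x. ereal m \<le> \<Omega> x" and fin: "\<Omega> xdag = ereal w"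
  shows "convex_on {0<..} (\<lambda>r. real_of_ereal (D_fun A \<Omega> xdag r))"
proof (rule convex_onI)
  fix t r s :: real
  assume t: "0 < t" "t < 1" and rs: "r \<in> {0<..}" "s \<in> {0<..}"
  let ?d = "\<lambda>r. real_of_ereal (D_fun A \<Omega> xdag r)"
  have d: "D_fun A \<Omega> xdag r = ereal (?d r)" if "0 \<le> r" for r
    using D_fun_finite[where A = A and m = m and \<Omega> = \<Omega>, OF m fin that] by (simp add: ereal_real')
  have le: "w - v - r * norm (A x - A xdag) \<le> ?d r"
    if "0 \<le> r" and "\<Omega> x = ereal v" for r x v
  proof -
    have "\<Omega> xdag - \<Omega> x - ereal (r * norm (A x - A xdag)) \<le> D_fun A \<Omega> xdag r"
      unfolding D_fun_def by (rule SUP_upper) simp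
    also have "\<dots> = ereal (?d r)"
      by (rule d[OF that(1)])
    finally show ?thesis using that(2) fin by simp
  qed
  have "D_fun A \<Omega> xdag ((1 - t) * r + t * s) \<le> ereal ((1 - t) * ?d r + t * ?d s)"
    unfolding D_fun_def[of _ _ _ "(1 - t) * r + t * s"]
  proof (rule SUP_least)
    fix x
    let ?n = "norm (A x - A xdag)"
    show "\<Omega> xdag - \<Omega> x - ereal (((1 - t) * r + t * s) * ?n) \<le> ereal ((1 - t) * ?d r + t * ?d s)"
    proof (cases "\<Omega> x")
      case (real v)
      have "(1 - t) * (w - v - r * ?n) + t * (w - v - s * ?n) \<le> (1 - t) * ?d r + t * ?d s"
        using t rs le[of r x v] le[of s x v] real by (intro add_mono mult_left_mono) auto
      then show ?thesis
        using real fin by (simp add: algebra_simps)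
    next
      case MInf
      with m[of x] show ?thesis by simp
    qed (simp add: fin)
  qed
  moreover have "0 \<le> (1 - t) * r + t * s"
    using t rs by simp
  ultimately show "?d ((1 - t) *\<^sub>R r + t *\<^sub>R s) \<le> (1 - t) * ?d r + t * ?d s"
    by (metis d ereal_less_eq(3) real_scaleR_def)
qed simp

section \<open>Estimates for the dual element and the residual\<close>

text \<open>The growth of the power over increments of length \<open>s\<close> bounds every
  subgradient. Taking \<open>s\<close> as the noise level later makes the bound scale like
  \<open>\<delta> powr (p - 1)\<close>, also for a vanishing residual.\<close>

lemma norm_subgradient_power_le:
  fixes y :: "'b::real_normed_vector"
  assumes \<zeta>: "\<zeta> \<in> subdifferential (\<lambda>y. ereal (1 / p * norm y powr p)) y"
    and "0 < p" "0 < s"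
  shows "norm \<zeta> \<le> (norm y + s) powr p / (p * s)"
proof -
  have bound: "\<zeta> h \<le> (norm y + s) powr p / (p * s) * norm h" for h :: 'b
  proof (cases "h = 0")
    case False
    \<comment> \<open>The direction \<open>h\<close> is rescaled to length \<open>s\<close>;
      linearity of \<open>\<zeta>\<close> recovers the bound at \<open>h\<close>.\<close>
    define k where "k = (s / norm h) *\<^sub>R h"
    have k: "norm k = s"
      using False \<open>0 < s\<close> by (simp add: k_def)
    have "1 / p * norm y powr p + \<zeta> k \<le> 1 / p * norm (y + k) powr p"
      using \<zeta> unfolding subdifferential_def by (auto dest: spec[of _ "y + k"])
    also have "\<dots> \<le> 1 / p * (norm y + s) powr p"
      using norm_triangle_ineq[of y k] \<open>0 < p\<close> k by (intro mult_left_mono powr_mono2) auto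
    finally have "\<zeta> k \<le> 1 / p * (norm y + s) powr p"
      using \<open>0 < p\<close> by (smt (verit) divide_nonneg_pos mult_nonneg_nonneg powr_ge_zero)
    moreover have "\<zeta> k = s / norm h * \<zeta> h"
      by (simp add: k_def blinfun.scaleR_right)
    ultimately show ?thesis
      using False \<open>0 < p\<close> \<open>0 < s\<close> by (simp add: field_simps)
  qed (simp add: blinfun.zero_right)
  have "norm (\<zeta> h) \<le> (norm y + s) powr p / (p * s) * norm h" for h
    using bound[of h] bound[of "- h"] by (auto simp: blinfun.minus_right abs_if)
  then show ?thesis
    using \<open>0 < p\<close> \<open>0 < s\<close> by (intro norm_blinfun_bound) auto
qed

text \<open>After inserting the subgradient inequality at \<open>x\<close>, only
  \<open>- \<eta> (A z - A xdag)\<close> remains besides the Bregman distance, and the penalty of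
  slope \<open>norm \<eta>\<close> absorbs it.\<close>

lemma D_fun_norm_le_bregman_distance:
  assumes \<xi>: "banach_adjoint A \<eta> \<in> subdifferential \<Omega> x" and fin: "\<Omega> xdag = ereal w"
    and nm: "\<And>x. \<Omega> x \<noteq> -\<infinity>"
  shows "D_fun A \<Omega> xdag (norm \<eta>) \<le> bregman_distance \<Omega> (banach_adjoint A \<eta>) xdag x"
  unfolding D_fun_def
proof (rule SUP_least)
  fix z
  obtain v where v: "\<Omega> x = ereal v"
    using \<xi> unfolding subdifferential_def by (cases "\<Omega> x") auto
  have sub: "ereal v + ereal (\<eta> (A (z - x))) \<le> \<Omega> z"
    using \<xi> v unfolding subdifferential_def banach_adjoint_def by auto
  show "\<Omega> xdag - \<Omega> z - ereal (norm \<eta> * norm (A z - A xdag))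
      \<le> bregman_distance \<Omega> (banach_adjoint A \<eta>) xdag x"
  proof (cases "\<Omega> z")
    case (real u)
    have "- \<eta> (A z - A xdag) \<le> norm \<eta> * norm (A z - A xdag)"
      using norm_blinfun[of \<eta> "A z - A xdag"] by simp
    then show ?thesis
      using sub real fin v
      by (simp add: bregman_distance_def banach_adjoint_def blinfun.diff_right)
  next
    case MInf
    with nm show ?thesis by blast
  qed (simp add: fin)
qed

text \<open>For \<open>t > 1\<close> the affine side is at most \<open>(1 + a + b) * t\<close>, and
  dividing by \<open>t\<close> leaves the positive exponent \<open>p - 1\<close>. The summand 1
  keeps the bound at least 1, which covers \<open>t \<le> 1\<close>.\<close>

lemma le_of_powr_le_affine:
  fixes t p a b :: real
  assumes "1 < p" "0 \<le> a" "0 \<le> b" "t powr p \<le> a + b * t"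
  shows "t \<le> (1 + a + b) powr (1 / (p - 1))"
proof (cases "t \<le> 1")
  case True
  also have "1 \<le> (1 + a + b) powr (1 / (p - 1))"
    using assms by (intro ge_one_powr_ge_zero) auto
  finally show ?thesis .
next
  case False
  have "t * t powr (p - 1) = t powr p"
    using False by (simp add: powr_diff)
  also have "\<dots> \<le> t * (1 + a + b)"
    using assms False mult_left_mono[of 1 t a] by (simp add: algebra_simps)
  finally have "t powr (p - 1) \<le> 1 + a + b"
    using False by simp
  then have "(t powr (p - 1)) powr (1 / (p - 1)) \<le> (1 + a + b) powr (1 / (p - 1))"
    using assms by (intro powr_mono2) auto
  then show ?thesis
    using assms False by (simp add: powr_powr)
qed

lemma tikhonov_residual_le:
  assumes min: "tikhonov_minimizer A p \<Omega> a yd x" and noise: "norm (yd - A xdag) \<le> \<delta>"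
    and fin: "\<Omega> xdag = ereal w" "\<Omega> x = ereal v"
    and D: "D_fun A \<Omega> xdag r = ereal (r * \<delta>)"
    and a: "0 \<le> a" "a * r \<le> c * \<delta> powr (p - 1)"
    and pos: "1 < p" "0 < \<delta>" "0 < r" "0 \<le> c"
  shows "norm (A x - yd) \<le> (2 + 3 * p * c) powr (1 / (p - 1)) * \<delta>"
proof -
  define R where "R = norm (A x - yd)"
  have "1 / p * R powr p + a * v \<le> 1 / p * norm (A xdag - yd) powr p + a * w"
    using min fin unfolding tikhonov_minimizer_def is_arg_min_def tikhonov_def R_def
    by (auto simp: not_less dest: spec[of _ xdag])
  also have "norm (A xdag - yd) powr p \<le> \<delta> powr p"
    using noise pos by (intro powr_mono2) (auto simp: norm_minus_commute)
  finally have "1 / p * R powr p + a * v \<le> 1 / p * \<delta> powr p + a * w"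
    using pos by (simp add: divide_right_mono)
  moreover have "a * (w - v) \<le> a * (r * (2 * \<delta> + R))"
  proof (rule mult_left_mono[OF _ a(1)])
    \<comment> \<open>The supremum \<open>D_fun\<close> evaluated at the minimizer acts as a source
      condition: it trades the gap in \<open>\<Omega>\<close> for a residual term.\<close>
    have "\<Omega> xdag - \<Omega> x - ereal (r * norm (A x - A xdag)) \<le> ereal (r * \<delta>)"
      unfolding D[symmetric] D_fun_def by (rule SUP_upper) simp
    then have "w - v \<le> r * (\<delta> + norm (A x - A xdag))"
      by (simp add: fin algebra_simps)
    also have "norm (A x - A xdag) \<le> R + \<delta>"
      using norm_triangle_ineq[of "A x - yd" "yd - A xdag"] noise by (simp add: R_def)
    finally show "w - v \<le> r * (2 * \<delta> + R)"
      using pos by (simp add: algebra_simps)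
  qed
  moreover have "a * r * (2 * \<delta> + R) \<le> c * \<delta> powr (p - 1) * (2 * \<delta> + R)"
    using a(2) pos by (intro mult_right_mono) (auto simp: R_def)
  ultimately have "1 / p * R powr p \<le> 1 / p * \<delta> powr p + c * \<delta> powr (p - 1) * (2 * \<delta> + R)"
    by (simp add: algebra_simps)
  then have "R powr p \<le> \<delta> powr p + p * (c * \<delta> powr (p - 1) * (2 * \<delta> + R))"
    using pos by (simp add: field_simps)
  also have "\<dots> = \<delta> powr p * (1 + 2 * p * c + p * c * (R / \<delta>))"
    using pos by (simp add: powr_diff field_simps)
  \<comment> \<open>Division by \<open>\<delta> powr p\<close> leaves an inequality for
    \<open>R / \<delta>\<close> alone, with coefficients free of \<open>\<delta>\<close>. Adding 1
    to their sum gives the base \<open>2 + 3 * p * c\<close>.\<close>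
  finally have "(R / \<delta>) powr p \<le> (1 + 2 * p * c) + p * c * (R / \<delta>)"
    using pos by (simp add: powr_divide R_def field_simps)
  then have "R / \<delta> \<le> (1 + (1 + 2 * p * c) + p * c) powr (1 / (p - 1))"
    using pos by (intro le_of_powr_le_affine) auto
  then show ?thesis
    using pos by (simp add: R_def field_simps)
qed

theorem theorem9:
  fixes A :: "'a::banach \<Rightarrow>\<^sub>L 'b::banach"
    and ydag :: 'b
    and p :: real
    and \<Omega> :: "'a \<Rightarrow> ereal"
    and xdag :: 'a
    and c1 c2 :: real
    and \<alpha> :: "real \<Rightarrow> real"
  assumes "p > 1"
    and "\<exists>x. blinfun_apply A x = ydag \<and> \<Omega> x < \<infinity>"
    and "proper_fun \<Omega>"
    and "convex_fun \<Omega>"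
    and "\<And>c::real. weakly_seq_closed {x. \<Omega> x \<le> ereal c}"
    and "\<And>c::real. has_weakly_convergent_subseqs {x. \<Omega> x \<le> ereal c}"
    and "Omega_min_solution A ydag \<Omega> xdag"
    and "\<And>r. r \<ge> 0 \<Longrightarrow> D_fun A \<Omega> xdag r > 0"
    and "c1 > 0" and "c2 > 0"
    and "\<And>\<delta>. \<delta> > 0 \<Longrightarrow> \<alpha> \<delta> > 0"
    and "\<And>\<delta>. \<delta> > 0 \<Longrightarrow>
      c1 * (\<delta> powr p / real_of_ereal (D_fun A \<Omega> xdag (Phi_inv A \<Omega> xdag \<delta>))) \<le> \<alpha> \<delta>"
    and "\<And>\<delta>. \<delta> > 0 \<Longrightarrow>
      \<alpha> \<delta> \<le> c2 * (\<delta> powr p / real_of_ereal (D_fun A \<Omega> xdag (Phi_inv A \<Omega> xdag \<delta>)))"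
  shows "\<exists>c>0. \<forall>\<delta>>0. \<forall>yd. norm (yd - ydag) \<le> \<delta> \<longrightarrow>
    (\<forall>x. tikhonov_minimizer A p \<Omega> (\<alpha> \<delta>) yd x \<longrightarrow>
      (\<forall>\<eta> \<in> dual_optimal A p \<Omega> (\<alpha> \<delta>) yd x.
        D_fun A \<Omega> xdag (c * Phi_inv A \<Omega> xdag \<delta>)
          \<le> bregman_distance \<Omega> (banach_adjoint A \<eta>) xdag x))"
proof -
  note p = \<open>p > 1\<close>
  let ?D = "D_fun A \<Omega> xdag" and ?Q = "Phi_inv A \<Omega> xdag"
  let ?d = "\<lambda>r. real_of_ereal (?D r)"
  have nm: "\<Omega> x \<noteq> -\<infinity>" for x
    using \<open>proper_fun \<Omega>\<close> by (simp add: proper_fun_def)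
  obtain m where m: "\<And>x. ereal m \<le> \<Omega> x"
    using bounded_below_of_weakly_compact_sublevels[of \<Omega>] nm assms(5,6) by blast
  \<comment> \<open>Minimality against a solution of finite \<open>\<Omega>\<close> makes
    \<open>\<Omega> xdag\<close> finite.\<close>
  have ydag: "A xdag = ydag" and "\<Omega> xdag < \<infinity>"
    using assms(2,7) unfolding Omega_min_solution_def is_arg_min_def
    by (auto simp: not_less dest: order.strict_trans1 order.not_eq_order_implies_strict)
  then obtain w where w: "\<Omega> xdag = ereal w"
    using nm[of xdag] by (cases "\<Omega> xdag") auto
  have d: "?D r = ereal (?d r)" if "0 \<le> r" for r
    using D_fun_finite[where A = A and m = m and \<Omega> = \<Omega>, OF m w that] by (simp add: ereal_real')
  have "bij_betw (\<lambda>r. ?d r / r) {0<..} {0<..}"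
  proof (rule bij_betw_convex_antimono_divide)
    show "convex_on {0<..} ?d"
      by (rule convex_on_D_fun[where m = m and \<Omega> = \<Omega>, OF m w])
    show "?d s \<le> ?d r" if "0 < r" "r \<le> s" for r s
      using D_fun_antimono[OF that(2), of A \<Omega> xdag] d[of r] d[of s] that
      by (metis ereal_less_eq(3) less_eq_real_def order_trans)
    show "0 < ?d r" if "0 < r" for r
      using assms(8)[of r] d[of r] that by (simp flip: ereal_less(2))
  qed
  \<comment> \<open>This makes \<open>Phi_inv\<close>, formed with \<open>the_inv_into\<close>, a
    genuine inverse with positive values.\<close>
  then have bij: "bij_betw (Phi_fun A \<Omega> xdag) {0<..} {0<..}"
    by (simp add: Phi_fun_def[abs_def])
  \<comment> \<open>\<open>C\<close> is the residual constant for the upper parameter bound;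
    \<open>K\<close> is the subgradient bound at residual \<open>C * \<delta>\<close> and
    \<open>s = \<delta>\<close>, divided by \<open>\<delta> powr (p - 1)\<close>. Neither depends on
    \<open>\<delta>\<close>.\<close>
  define C where "C = (2 + 3 * p * c2) powr (1 / (p - 1))"
  define K where "K = (C + 1) powr p / p"
  have "0 \<le> C"
    by (simp add: C_def)
  then have "0 < K"
    using p by (simp add: K_def)
  show ?thesis
  proof (intro exI[of _ "K / c1"] conjI allI impI ballI)
    show "0 < K / c1"
      using \<open>0 < K\<close> \<open>c1 > 0\<close> by simp
    fix \<delta> yd x \<eta>
    assume \<delta>: "0 < \<delta>" and noise: "norm (yd - ydag) \<le> \<delta>"
      and min: "tikhonov_minimizer A p \<Omega> (\<alpha> \<delta>) yd x"
      and \<eta>: "\<eta> \<in> dual_optimal A p \<Omega> (\<alpha> \<delta>) yd x"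
    define r where "r = ?Q \<delta>"
    have r: "0 < r"
      using bij_betw_the_inv_into[OF bij] \<delta> unfolding r_def Phi_inv_def bij_betw_def by auto
    have "Phi_fun A \<Omega> xdag r = \<delta>"
      using f_the_inv_into_f_bij_betw[OF bij] \<delta> unfolding r_def Phi_inv_def by simp
    then have dr: "?d r = r * \<delta>"
      using r by (auto simp: Phi_fun_def field_simps)
    have a: "0 < \<alpha> \<delta>"
      by (rule assms(11)[OF \<delta>])
    have lower: "c1 * \<delta> powr (p - 1) \<le> \<alpha> \<delta> * r" and upper: "\<alpha> \<delta> * r \<le> c2 * \<delta> powr (p - 1)"
      using assms(12,13)[OF \<delta>] r \<delta> dr unfolding r_def[symmetric]
      by (simp_all add: powr_diff field_simps)
    obtain \<zeta> where \<zeta>: "\<zeta> \<in> subdifferential (\<lambda>y. ereal (1 / p * norm y powr p)) (A x - yd)"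
        "\<eta> = - (1 / \<alpha> \<delta>) *\<^sub>R \<zeta>" and \<xi>: "banach_adjoint A \<eta> \<in> subdifferential \<Omega> x"
      using \<eta> unfolding dual_optimal_def by blast
    obtain v where v: "\<Omega> x = ereal v"
      using \<xi> unfolding subdifferential_def by (cases "\<Omega> x") auto
    \<comment> \<open>Here the upper bound on \<open>\<alpha> \<delta>\<close> enters.\<close>
    have "norm (A x - yd) \<le> C * \<delta>"
      unfolding C_def
      by (rule tikhonov_residual_le[where r = r, OF min _ w v])
        (use noise ydag d[of r] dr a upper p \<delta> r \<open>c2 > 0\<close> in auto)
    then have "(norm (A x - yd) + \<delta>) powr p \<le> ((C + 1) * \<delta>) powr p"
      using p \<delta> by (intro powr_mono2) (auto simp: algebra_simps)
    then have "(norm (A x - yd) + \<delta>) powr p / (p * \<delta>) \<le> ((C + 1) * \<delta>) powr p / (p * \<delta>)"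
      using p \<delta> by (intro divide_right_mono) auto
    also have "\<dots> = K * \<delta> powr (p - 1)"
      using \<open>0 \<le> C\<close> \<delta> by (simp add: K_def powr_mult powr_diff)
    finally have "norm \<zeta> \<le> K * \<delta> powr (p - 1)"
      using norm_subgradient_power_le[OF \<zeta>(1), of \<delta>] p \<delta> by simp
    then have "norm \<eta> \<le> K * \<delta> powr (p - 1) / \<alpha> \<delta>"
      using a by (simp add: \<zeta>(2) divide_right_mono)
    \<comment> \<open>The lower bound on \<open>\<alpha> \<delta>\<close> replaces
      \<open>\<delta> powr (p - 1) / \<alpha> \<delta>\<close> by \<open>r / c1\<close>, which is
      the origin of the constant \<open>K / c1\<close>.\<close>
    also have "\<dots> \<le> K / c1 * r"
      using mult_left_mono[OF lower, of K] \<open>0 < K\<close> \<open>c1 > 0\<close> a by (simp add: field_simps)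
    finally have "?D (K / c1 * r) \<le> ?D (norm \<eta>)"
      by (rule D_fun_antimono)
    also have "\<dots> \<le> bregman_distance \<Omega> (banach_adjoint A \<eta>) xdag x"
      by (rule D_fun_norm_le_bregman_distance[OF \<xi> w nm])
    finally show "?D (K / c1 * ?Q \<delta>) \<le> bregman_distance \<Omega> (banach_adjoint A \<eta>) xdag x"
      unfolding r_def .
  qed
qed

end
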